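(* Let $P$ be a fixed finite poset that is neither a chain nor an antichain. Then, as $n\to\infty$: (i) if $P$ contains a weak good incomparable pair, then $\mathrm{ar}_m(n,2^n,P)=(1+o(1))2^n$; (ii) if all incomparable pairs of $P$ are weak bad, then $\mathrm{ar}_m(n,2^n,P)=\left(\tfrac12+o(1)\right)2^n$.
   Context: $[n]=\{1,\dots,n\}$. A family $\mathcal G$ of sets is a weak copy of a poset $(P,\preceq)$ if there is a bijection $\iota:P\to\mathcal G$ such that $p\preceq q$ implies $\iota(p)\subseteq\iota(q)$. A copy is rainbow under a coloring if all its sets receive distinct colors. For $1<m\le 2^n$, $\mathrm{ar}_m(n,m,P)$ is the minimum integer $k$ such that there exist $\mathcal F\subseteq 2^{[n]}$ with $|\mathcal F|=m$ and a coloring $\mathcal F\to[k]$ under which every weak copy of $P$ contained in $\mathcal F$ is rainbow. (For $m=2^n$ the only choice is $\mathcal F=2^{[n]}$.) For $x\in P$ let $U_P(x)=\{y\in P: x\prec y\}$ and $D_P(x)=\{y\in P: y\prec x\}$ (strict relations). A pair $p,q\in P$ of incomparable elements is weak bad if $|U_P(p)\cap U_P(q)|\ge 2$ or $|D_P(p)\cap D_P(q)|\ge 2$; an incomparable pair that is not weak bad is weak good. *)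

theory Defs
  imports Complex_Main "HOL-Library.FuncSet" "HOL-Library.Landau_Symbols"
begin

text \<open>
  A poset is a carrier set \<open>P\<close> together with a relation \<open>r\<close> such that
  \<open>partial_order_on P r\<close>; \<open>(p, q) \<in> r\<close> means $p \preceq q$.
\<close>

definition poset_antichain :: "'a set \<Rightarrow> 'a rel \<Rightarrow> bool" where
  "poset_antichain P r \<longleftrightarrow> (\<forall>p\<in>P. \<forall>q\<in>P. (p, q) \<in> r \<longrightarrow> p = q)"

definition weak_copy :: "'a set \<Rightarrow> 'a rel \<Rightarrow> nat set set \<Rightarrow> bool" where
  "weak_copy P r G \<longleftrightarrow>
     (\<exists>\<iota>. bij_betw \<iota> P G \<and> (\<forall>p\<in>P. \<forall>q\<in>P. (p, q) \<in> r \<longrightarrow> \<iota> p \<subseteq> \<iota> q))"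

text \<open>
  Only meaningful for \<open>1 < m \<le> 2 ^ n\<close>; then some \<open>k \<le> m\<close> qualifies, because an injective
  coloring makes every copy rainbow. The coloring need not be surjective onto \<open>{1..k}\<close>.
\<close>

definition ar_m :: "nat \<Rightarrow> nat \<Rightarrow> 'a set \<Rightarrow> 'a rel \<Rightarrow> nat" where
  "ar_m n m P r =
     (LEAST k. \<exists>F c. F \<subseteq> Pow {1..n} \<and> card F = m \<and> c \<in> F \<rightarrow> {1..k} \<and>
        (\<forall>G. G \<subseteq> F \<and> weak_copy P r G \<longrightarrow> inj_on c G))"

definition upper_set :: "'a set \<Rightarrow> 'a rel \<Rightarrow> 'a \<Rightarrow> 'a set" where
  "upper_set P r x = {y \<in> P. (x, y) \<in> r \<and> x \<noteq> y}"

definition lower_set :: "'a set \<Rightarrow> 'a rel \<Rightarrow> 'a \<Rightarrow> 'a set" where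
  "lower_set P r x = {y \<in> P. (y, x) \<in> r \<and> y \<noteq> x}"

definition incomparable :: "'a set \<Rightarrow> 'a rel \<Rightarrow> 'a \<Rightarrow> 'a \<Rightarrow> bool" where
  "incomparable P r p q \<longleftrightarrow> p \<in> P \<and> q \<in> P \<and> (p, q) \<notin> r \<and> (q, p) \<notin> r"

definition weak_bad :: "'a set \<Rightarrow> 'a rel \<Rightarrow> 'a \<Rightarrow> 'a \<Rightarrow> bool" where
  "weak_bad P r p q \<longleftrightarrow> incomparable P r p q \<and>
     (card (upper_set P r p \<inter> upper_set P r q) \<ge> 2 \<or>
      card (lower_set P r p \<inter> lower_set P r q) \<ge> 2)"

definition weak_good :: "'a set \<Rightarrow> 'a rel \<Rightarrow> 'a \<Rightarrow> 'a \<Rightarrow> bool" where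
  "weak_good P r p q \<longleftrightarrow> incomparable P r p q \<and> \<not> weak_bad P r p q"

end

theory Submission
  imports Defs
begin

text \<open>
  Two sets may share a color exactly when no weak copy of the poset \<open>P\<close> contains both, so
  everything depends on which pairs \<open>A\<close>, \<open>B\<close> can be completed to a copy. Nearly all subsets of
  \<open>{1..n}\<close> have about \<open>n / 2\<close> elements (\<open>card_middle_sets_ge\<close>, a Chebyshev bound), hence
  only pairs of such middle sets matter for lower bounds.

  Fix an incomparable pair \<open>p\<close>, \<open>q\<close> of \<open>P\<close> and place it at \<open>A\<close>, \<open>B\<close>. If \<open>A \<inter> B\<close> and the
  complement of \<open>A \<union> B\<close> have at least about \<open>card P\<close> points, the elements below \<open>p\<close> or \<open>q\<close> fit
  under \<open>A \<inter> B\<close> and all others above \<open>A \<union> B\<close> (\<open>weak_copy_through_pair_with_room\<close>). Two middle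
  sets violating this are nearly complementary, and no three sets are pairwise nearly
  complementary. So a color is used at most twice on middle sets, and at least
  \<open>(1 / 2 - o(1)) * 2 ^ n\<close> colors are needed.

  Nearly complementary sets do lie in a common copy if \<open>p\<close>, \<open>q\<close> is weak good: elements related to
  only one of \<open>p\<close>, \<open>q\<close>, or to neither, can be told apart by subsets of \<open>A - B\<close> and \<open>B - A\<close>, while
  the common upper bounds are forced above \<open>A \<union> B\<close> and the common lower bounds below \<open>A \<inter> B\<close>,
  where one bound of each kind always finds a place (\<open>weak_copy_through_good_pair\<close>). Then middle
  sets have distinct colors, which gives the first part.

  If all incomparable pairs are weak bad, exactly complementary sets \<open>A\<close>, \<open>B\<close> never lie in a
  common copy, apart from the pair of \<open>{}\<close> and \<open>{1..n}\<close>: a second common upper or lower bound has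
  no place, since only \<open>{1..n}\<close> contains both and only \<open>{}\<close> is contained in both. Giving
  complementary sets the same color therefore achieves \<open>2 ^ (n - 1) + 1\<close> colors
  (\<open>rainbow_complement_color\<close>), which matches the lower bound.
\<close>

section \<open>Rainbow colorings of the full power set\<close>

definition rainbow_coloring :: "nat \<Rightarrow> 'a set \<Rightarrow> 'a rel \<Rightarrow> (nat set \<Rightarrow> 'c) \<Rightarrow> bool" where
  "rainbow_coloring n P r c \<longleftrightarrow>
     (\<forall>G. G \<subseteq> Pow {1..n} \<and> weak_copy P r G \<longrightarrow> inj_on c G)"

lemma full_family: "F \<subseteq> Pow {1..n} \<and> card F = 2 ^ n \<longleftrightarrow> F = Pow {1..n::nat}"
  using card_subset_eq[of "Pow {1..n}" F] by (auto simp: card_Pow)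

lemma ar_m_full_eq_Least:
  "ar_m n (2 ^ n) P r =
     (LEAST k. \<exists>c \<in> Pow {1..n} \<rightarrow> {1..k}. rainbow_coloring n P r c)"
proof -
  have "(\<exists>F c. F \<subseteq> Pow {1..n} \<and> card F = 2 ^ n \<and> c \<in> F \<rightarrow> {1..k} \<and>
          (\<forall>G. G \<subseteq> F \<and> weak_copy P r G \<longrightarrow> inj_on c G)) \<longleftrightarrow>
        (\<exists>c \<in> Pow {1..n} \<rightarrow> {1..k}. rainbow_coloring n P r c)" for k :: nat
    unfolding rainbow_coloring_def conj_assoc[symmetric] full_family by blast
  then show ?thesis
    unfolding ar_m_def by (simp only:)
qed

text \<open>
  Only the number of colors matters, so a coloring with values in an arbitrary type may be
  used for upper bounds; its values are renumbered by \<open>1, 2, \<dots>\<close>.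
\<close>

lemma ar_m_full_le_card_image:
  assumes "rainbow_coloring n P r c"
  shows "ar_m n (2 ^ n) P r \<le> card (c ` Pow {1..n})"
proof -
  let ?I = "c ` Pow {1..n}"
  have "finite ?I" by simp
  then obtain h where h: "bij_betw h ?I {1..card ?I}"
    using ex_bij_betw_finite_nat[of ?I] bij_betw_iff_card[of ?I "{1..card ?I}"] by auto
  have "h \<circ> c \<in> Pow {1..n} \<rightarrow> {1..card ?I}"
    using bij_betwE[OF h] by auto
  moreover have "rainbow_coloring n P r (h \<circ> c)"
    unfolding rainbow_coloring_def
  proof (intro allI impI)
    fix G assume G: "G \<subseteq> Pow {1..n} \<and> weak_copy P r G"
    have "inj_on h (c ` G)"
      using h G by (meson bij_betw_def image_mono inj_on_subset)
    moreover have "inj_on c G"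
      using assms G by (auto simp: rainbow_coloring_def)
    ultimately show "inj_on (h \<circ> c) G" by (simp add: comp_inj_on)
  qed
  ultimately show ?thesis
    unfolding ar_m_full_eq_Least by (intro Least_le bexI)
qed

lemma ar_m_full_le: "ar_m n (2 ^ n) P r \<le> 2 ^ n"
  using ar_m_full_le_card_image[of n P r id] by (simp add: rainbow_coloring_def card_Pow)

lemma ar_m_full_attained:
  obtains c :: "nat set \<Rightarrow> nat"
  where "rainbow_coloring n P r c" "card (c ` Pow {1..n}) \<le> ar_m n (2 ^ n) P r"
proof -
  let ?Q = "\<lambda>k. \<exists>c \<in> Pow {1..n} \<rightarrow> {1..k::nat}. rainbow_coloring n P r c"
  obtain h :: "nat set \<Rightarrow> nat" where h: "bij_betw h (Pow {1..n}) {1..2 ^ n}"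
    using bij_betw_iff_card[of "Pow {1..n}" "{1..2 ^ n::nat}"] by (auto simp: card_Pow)
  have "?Q (2 ^ n)"
    using h by (intro bexI[of _ h])
      (auto simp: rainbow_coloring_def bij_betw_def intro: inj_on_subset)
  then have "?Q (ar_m n (2 ^ n) P r)"
    unfolding ar_m_full_eq_Least by (rule LeastI)
  then obtain c where c: "c \<in> Pow {1..n} \<rightarrow> {1..ar_m n (2 ^ n) P r}"
    "rainbow_coloring n P r c" by blast
  have "card (c ` Pow {1..n}) \<le> card {1..ar_m n (2 ^ n) P r}"
    using c(1) by (intro card_mono) auto
  with c(2) show thesis by (intro that) auto
qed

lemma rainbow_coloring_separates:
  assumes "rainbow_coloring n P r c"
    and "\<exists>G \<subseteq> Pow {1..n}. weak_copy P r G \<and> A \<in> G \<and> B \<in> G"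
    and "A \<noteq> B"
  shows "c A \<noteq> c B"
  using assms by (metis inj_onD rainbow_coloring_def)

section \<open>Weak copies through two prescribed sets\<close>

text \<open>
  Label the elements of \<open>P\<close> by distinct points of \<open>C\<close> and send \<open>x\<close> to the labels of its
  principal down-set. Antisymmetry makes this injective, reflexivity makes the sets nonempty,
  and the bound on their size makes them proper subsets of \<open>C\<close> as soon as \<open>C\<close> has more than
  \<open>card P\<close> points. Nonemptiness and properness keep these sets apart from the two
  extreme values \<open>{}\<close> and \<open>C\<close> in the embeddings below.
\<close>

lemma poset_embeds_in_Pow:
  assumes "finite P" "partial_order_on P r" "finite C" "card P \<le> card C"
  obtains S :: "'a \<Rightarrow> 'b set"
  where "\<And>x. x \<in> P \<Longrightarrow> S x \<subseteq> C" "\<And>x. x \<in> P \<Longrightarrow> S x \<noteq> {}"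
    "\<And>x. x \<in> P \<Longrightarrow> card (S x) \<le> card P" "inj_on S P"
    "\<And>x y. x \<in> P \<Longrightarrow> y \<in> P \<Longrightarrow> (x, y) \<in> r \<Longrightarrow> S x \<subseteq> S y"
proof -
  obtain e where e: "e ` P \<subseteq> C" "inj_on e P"
    using card_le_inj[OF assms(1,3,4)] by blast
  define S where "S x = e ` {y \<in> P. (y, x) \<in> r}" for x
  have po: "\<And>x. x \<in> P \<Longrightarrow> (x, x) \<in> r" "trans r" "antisym r"
    using assms(2) by (auto simp: partial_order_on_def preorder_on_def refl_on_def)
  show thesis
  proof (rule that[of S])
    show "S x \<subseteq> C" for x using e by (auto simp: S_def)
    show "S x \<noteq> {}" if "x \<in> P" for x using po(1) that by (auto simp: S_def)
    show "card (S x) \<le> card P" for x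
    proof -
      have "card (S x) \<le> card {y \<in> P. (y, x) \<in> r}"
        unfolding S_def using assms(1) by (intro card_image_le) auto
      also have "\<dots> \<le> card P"
        using assms(1) by (intro card_mono) auto
      finally show ?thesis .
    qed
    show "S x \<subseteq> S y" if "(x, y) \<in> r" for x y
      using that po(2) by (auto simp: S_def dest: transD)
    show "inj_on S P"
    proof (rule inj_onI)
      fix x y assume xy: "x \<in> P" "y \<in> P" "S x = S y"
      then have "e x \<in> S y" "e y \<in> S x" using po(1) by (auto simp: S_def)
      then have "(x, y) \<in> r" "(y, x) \<in> r"
        using e(2) xy(1,2) by (auto simp: S_def inj_on_eq_iff)
      then show "x = y" using po(3) by (auto dest: antisymD)
    qed
  qed
qed

lemma weak_copy_through:
  assumes "inj_on f P" "\<And>x. x \<in> P \<Longrightarrow> f x \<subseteq> X"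
    and "\<And>x y. x \<in> P \<Longrightarrow> y \<in> P \<Longrightarrow> (x, y) \<in> r \<Longrightarrow> f x \<subseteq> f y"
    and "p \<in> P" "q \<in> P"
  shows "\<exists>G \<subseteq> Pow X. weak_copy P r G \<and> f p \<in> G \<and> f q \<in> G"
proof (intro exI conjI)
  show "weak_copy P r (f ` P)"
    unfolding weak_copy_def using assms(1,3) by (meson inj_on_imp_bij_betw)
qed (use assms in auto)

text \<open>
  Since \<open>p\<close> and \<open>q\<close> are incomparable, \<open>P\<close> splits into the elements below one of them, the two
  elements themselves, and the rest, and no relation leads from a later block to an earlier one.
  So \<open>p\<close> and \<open>q\<close> go to \<open>A\<close> and \<open>B\<close>, the lower block is squeezed strictly below
  \<open>A \<inter> B\<close> and the upper block strictly above \<open>A \<union> B\<close>. A weak copy may have additional inclusions,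
  so \<open>A\<close> and \<open>B\<close> themselves may be comparable.
\<close>

lemma weak_copy_through_pair_with_room:
  assumes P: "finite P" "partial_order_on P r" "incomparable P r p q"
    and X: "finite X" "A \<subseteq> X" "B \<subseteq> X" "A \<noteq> B"
    and below: "card P < card (A \<inter> B)" and above: "card P \<le> card (X - (A \<union> B))"
  shows "\<exists>G \<subseteq> Pow X. weak_copy P r G \<and> A \<in> G \<and> B \<in> G"
proof -
  have fin: "finite (A \<inter> B)" "finite (X - (A \<union> B))"
    using X by (auto intro: finite_subset)
  obtain S where S: "\<And>x. x \<in> P \<Longrightarrow> S x \<subseteq> A \<inter> B"
    "\<And>x. x \<in> P \<Longrightarrow> card (S x) \<le> card P" "inj_on S P"
    "\<And>x y. x \<in> P \<Longrightarrow> y \<in> P \<Longrightarrow> (x, y) \<in> r \<Longrightarrow> S x \<subseteq> S y"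
    using poset_embeds_in_Pow[OF P(1,2) fin(1) less_imp_le[OF below]] by metis
  obtain T where T: "\<And>x. x \<in> P \<Longrightarrow> T x \<subseteq> X - (A \<union> B)" "\<And>x. x \<in> P \<Longrightarrow> T x \<noteq> {}"
    "inj_on T P" "\<And>x y. x \<in> P \<Longrightarrow> y \<in> P \<Longrightarrow> (x, y) \<in> r \<Longrightarrow> T x \<subseteq> T y"
    using poset_embeds_in_Pow[OF P(1,2) fin(2) above] by metis
  have S_proper: "S x \<subset> A \<inter> B" if "x \<in> P" for x
    using S(1,2)[OF that] below by (metis leD psubsetI)
  have po: "\<And>x. x \<in> P \<Longrightarrow> (x, x) \<in> r" "trans r" "antisym r"
    using P(2) by (auto simp: partial_order_on_def preorder_on_def refl_on_def)
  have pq: "p \<in> P" "q \<in> P" "(p, q) \<notin> r" "(q, p) \<notin> r" "p \<noteq> q"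
    using P(3) po(1) by (auto simp: incomparable_def)
  define f where "f x =
    (if x = p then A else if x = q then B
     else if (x, p) \<in> r \<or> (x, q) \<in> r then S x else A \<union> B \<union> T x)" for x
  have low: "f x = S x" if "x \<noteq> p" "x \<noteq> q" "(x, p) \<in> r \<or> (x, q) \<in> r" for x
    using that by (auto simp: f_def)
  have high: "f x = A \<union> B \<union> T x" if "(x, p) \<notin> r" "(x, q) \<notin> r" "x \<in> P" for x
    using that po(1) pq by (auto simp: f_def)
  have fpq: "f p = A" "f q = B" using pq by (auto simp: f_def)
  \<comment> \<open>The trace of \<open>f x\<close> on \<open>A \<inter> B\<close> identifies the lower block, its trace outside \<open>A \<union> B\<close>
      the upper one; injectivity of \<open>S\<close> and \<open>T\<close> then identifies \<open>x\<close> within its block.\<close>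
  have below_trace: "f x \<inter> (A \<inter> B) =
      (if x \<noteq> p \<and> x \<noteq> q \<and> ((x, p) \<in> r \<or> (x, q) \<in> r) then S x else A \<inter> B)" if "x \<in> P" for x
    using S(1)[OF that] by (auto simp: f_def)
  have above_trace: "f x - (A \<union> B) = (if (x, p) \<notin> r \<and> (x, q) \<notin> r then T x else {})"
    if "x \<in> P" for x
    using S(1)[OF that] T(1)[OF that] po(1) pq by (auto simp: f_def)
  have "inj_on f P"
  proof (rule inj_onI)
    fix x y assume xy: "x \<in> P" "y \<in> P" "f x = f y"
    let ?low = "\<lambda>x. x \<noteq> p \<and> x \<noteq> q \<and> ((x, p) \<in> r \<or> (x, q) \<in> r)"
      and ?high = "\<lambda>x. (x, p) \<notin> r \<and> (x, q) \<notin> r"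
    have eq: "(if ?low x then S x else A \<inter> B) = (if ?low y then S y else A \<inter> B)"
      "(if ?high x then T x else {}) = (if ?high y then T y else {})"
      unfolding below_trace[OF xy(1), symmetric] below_trace[OF xy(2), symmetric]
        above_trace[OF xy(1), symmetric] above_trace[OF xy(2), symmetric] xy(3) by (rule refl)+
    have S_ne: "S x \<noteq> A \<inter> B" "S y \<noteq> A \<inter> B" using S_proper xy(1,2) by blast+
    consider "?low x" | "?high x" | "x = p \<or> x = q" by blast
    then show "x = y"
    proof cases
      case 1
      then have "S x = S y" using eq(1) S_ne by presburger
      then show ?thesis using S(3) xy(1,2) by (simp add: inj_on_eq_iff)
    next
      case 2
      then have "T x = T y" using eq(2) T(2)[OF xy(1)] by presburger
      then show ?thesis using T(3) xy(1,2) by (simp add: inj_on_eq_iff)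
    next
      case 3
      then have "\<not> ?low x" "\<not> ?high x" using po(1) pq(1,2) by blast+
      then have "\<not> ?low y" "\<not> ?high y" using eq S_ne T(2)[OF xy(2)] by argo+
      then have "y = p \<or> y = q" by blast
      with 3 show ?thesis using xy(3) fpq X(4) by auto
    qed
  qed
  moreover have "f x \<subseteq> X" if "x \<in> P" for x
    using that S(1)[of x] T(1)[of x] X by (auto simp: f_def)
  moreover have "f x \<subseteq> f y" if xy: "x \<in> P" "y \<in> P" "(x, y) \<in> r" for x y
  proof (cases "(y, p) \<in> r \<or> (y, q) \<in> r")
    case True
    then have x: "(x, p) \<in> r \<or> (x, q) \<in> r" using xy po(2) by (blast dest: transD)
    have above_p: "y = p" if "x = p"
      using True that xy pq po(2,3) by (metis antisymD transD)
    have above_q: "y = q" if "x = q"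
      using True that xy pq po(2,3) by (metis antisymD transD)
    show ?thesis
    proof (cases "x = p \<or> x = q")
      case True
      then show ?thesis using above_p above_q by blast
    next
      case False
      then have "f x = S x" using low x by blast
      moreover have "S x \<subseteq> A \<inter> B" "S x \<subseteq> S y" using S(1,4) xy by blast+
      moreover have "f y = S y" if "y \<noteq> p" "y \<noteq> q" using low that True by blast
      ultimately show ?thesis using fpq by (metis Int_subset_iff)
    qed
  next
    case False
    then show ?thesis
      using high[of y] S(1)[of x] T(4)[of x y] xy by (auto simp: f_def)
  qed
  ultimately show ?thesis
    using weak_copy_through[of f P X r p q] pq(1,2) unfolding fpq by blast
qed

text \<open>
  The image of \<open>x\<close> is assembled from a part \<open>\<alpha> x \<subseteq> A\<close>, which is all of \<open>A\<close> above \<open>p\<close>, empty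
  below \<open>q\<close> (where the image must stay inside \<open>B\<close>), and otherwise a proper nonempty subset \<open>S x\<close> of \<open>A - B\<close>, and from a part
  \<open>\<beta> x \<subseteq> B\<close> built symmetrically. The traces on \<open>A - B\<close> and \<open>B - A\<close> recover \<open>x\<close> whenever one
  of them is proper and nonempty. Otherwise the pair of traces is (full, full), (empty, empty),
  (full, empty) or (empty, full): then \<open>x\<close> is a common upper bound of \<open>p\<close> and \<open>q\<close>, a
  common lower bound, \<open>p\<close>, or \<open>q\<close>. A weak good pair has at most one bound of each kind, so
  \<open>x\<close> is determined. No point outside \<open>A \<union> B\<close> and no point of \<open>A \<inter> B\<close> is used as a label,
  so even complementary \<open>A\<close> and \<open>B\<close> are covered.
\<close>

lemma weak_copy_through_good_pair:
  assumes P: "finite P" "partial_order_on P r" "weak_good P r p q"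
    and X: "finite X" "A \<subseteq> X" "B \<subseteq> X"
    and left: "card P < card (A - B)" and right: "card P < card (B - A)"
  shows "\<exists>G \<subseteq> Pow X. weak_copy P r G \<and> A \<in> G \<and> B \<in> G"
proof -
  have fin: "finite (A - B)" "finite (B - A)"
    using X by (meson Diff_subset finite_subset)+
  obtain S where S: "\<And>x. x \<in> P \<Longrightarrow> S x \<subseteq> A - B" "\<And>x. x \<in> P \<Longrightarrow> S x \<noteq> {}"
    "\<And>x. x \<in> P \<Longrightarrow> card (S x) \<le> card P" "inj_on S P"
    "\<And>x y. x \<in> P \<Longrightarrow> y \<in> P \<Longrightarrow> (x, y) \<in> r \<Longrightarrow> S x \<subseteq> S y"
    using poset_embeds_in_Pow[OF P(1,2) fin(1) less_imp_le[OF left]] by metis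
  obtain T where T: "\<And>x. x \<in> P \<Longrightarrow> T x \<subseteq> B - A" "\<And>x. x \<in> P \<Longrightarrow> T x \<noteq> {}"
    "\<And>x. x \<in> P \<Longrightarrow> card (T x) \<le> card P" "inj_on T P"
    "\<And>x y. x \<in> P \<Longrightarrow> y \<in> P \<Longrightarrow> (x, y) \<in> r \<Longrightarrow> T x \<subseteq> T y"
    using poset_embeds_in_Pow[OF P(1,2) fin(2) less_imp_le[OF right]] by metis
  have S_proper: "S x \<noteq> A - B" if "x \<in> P" for x
    using S(3)[OF that] left by auto
  have T_proper: "T x \<noteq> B - A" if "x \<in> P" for x
    using T(3)[OF that] right by auto
  have po: "\<And>x. x \<in> P \<Longrightarrow> (x, x) \<in> r" "trans r" "antisym r"
    using P(2) by (auto simp: partial_order_on_def preorder_on_def refl_on_def)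
  have pq: "p \<in> P" "q \<in> P" "(p, q) \<notin> r" "(q, p) \<notin> r" "p \<noteq> q"
    using P(3) po(1) by (auto simp: weak_good_def incomparable_def)
  have le1_unique: "x = y" if "card Y < 2" "Y \<subseteq> P" "x \<in> Y" "y \<in> Y" for x y and Y :: "'a set"
    using that card_le_Suc0_iff_eq[of Y] finite_subset[OF _ P(1)] by auto
  have common_upper: "x = y"
    if "x \<in> P" "y \<in> P" "(p, x) \<in> r" "(q, x) \<in> r" "(p, y) \<in> r" "(q, y) \<in> r" for x y
    using P(3) that pq
    by (intro le1_unique[of "upper_set P r p \<inter> upper_set P r q"])
       (auto simp: weak_good_def weak_bad_def upper_set_def)
  have common_lower: "x = y"
    if "x \<in> P" "y \<in> P" "(x, p) \<in> r" "(x, q) \<in> r" "(y, p) \<in> r" "(y, q) \<in> r" for x y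
    using P(3) that pq
    by (intro le1_unique[of "lower_set P r p \<inter> lower_set P r q"])
       (auto simp: weak_good_def weak_bad_def lower_set_def)
  define \<alpha> where "\<alpha> x = (if (p, x) \<in> r then A else if (x, q) \<in> r then {} else S x)" for x
  define \<beta> where "\<beta> x = (if (q, x) \<in> r then B else if (x, p) \<in> r then {} else T x)" for x
  define f where "f x = \<alpha> x \<union> \<beta> x" for x
  have \<alpha>_mono: "\<alpha> x \<subseteq> \<alpha> y" if "x \<in> P" "y \<in> P" "(x, y) \<in> r" for x y
    using that S(1,5) pq po(2) unfolding \<alpha>_def by (auto dest: transD)
  have \<beta>_mono: "\<beta> x \<subseteq> \<beta> y" if "x \<in> P" "y \<in> P" "(x, y) \<in> r" for x y
    using that T(1,5) pq po(2) unfolding \<beta>_def by (auto dest: transD)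
  have fpq: "f p = A" "f q = B"
    using pq po(1) by (auto simp: f_def \<alpha>_def \<beta>_def)
  have traceA: "f x \<inter> (A - B) = (if (p, x) \<in> r then A - B else if (x, q) \<in> r then {} else S x)"
    if "x \<in> P" for x
    using S(1)[OF that] T(1)[OF that] by (auto simp: f_def \<alpha>_def \<beta>_def split: if_splits)
  have traceB: "f x \<inter> (B - A) = (if (q, x) \<in> r then B - A else if (x, p) \<in> r then {} else T x)"
    if "x \<in> P" for x
    using S(1)[OF that] T(1)[OF that] by (auto simp: f_def \<alpha>_def \<beta>_def split: if_splits)
  have ne: "A - B \<noteq> {}" "B - A \<noteq> {}" using left right by (metis card.empty not_less0)+
  have "inj_on f P"
  proof (rule inj_onI)
    fix x y assume xy: "x \<in> P" "y \<in> P" "f x = f y"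
    have eqA: "(if (p, x) \<in> r then A - B else if (x, q) \<in> r then {} else S x) =
      (if (p, y) \<in> r then A - B else if (y, q) \<in> r then {} else S y)"
      using traceA[OF xy(1)] traceA[OF xy(2)] xy(3) by simp
    have eqB: "(if (q, x) \<in> r then B - A else if (x, p) \<in> r then {} else T x) =
      (if (q, y) \<in> r then B - A else if (y, p) \<in> r then {} else T y)"
      using traceB[OF xy(1)] traceB[OF xy(2)] xy(3) by simp
    have A: "((p, x) \<in> r \<longleftrightarrow> (p, y) \<in> r) \<and>
      ((p, x) \<notin> r \<longrightarrow> ((x, q) \<in> r \<longleftrightarrow> (y, q) \<in> r) \<and> ((x, q) \<notin> r \<longrightarrow> x = y))"
      using eqA S(2)[OF xy(1)] S(2)[OF xy(2)] S_proper[OF xy(1)] S_proper[OF xy(2)]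
        inj_onD[OF S(4) _ xy(1,2)] ne(1) by (smt (verit))
    have B: "((q, x) \<in> r \<longleftrightarrow> (q, y) \<in> r) \<and>
      ((q, x) \<notin> r \<longrightarrow> ((x, p) \<in> r \<longleftrightarrow> (y, p) \<in> r) \<and> ((x, p) \<notin> r \<longrightarrow> x = y))"
      using eqB T(2)[OF xy(1)] T(2)[OF xy(2)] T_proper[OF xy(1)] T_proper[OF xy(2)]
        inj_onD[OF T(4) _ xy(1,2)] ne(2) by (smt (verit))
    show "x = y"
    proof (cases "(p, x) \<in> r"; cases "(q, x) \<in> r")
      assume "(p, x) \<in> r" "(q, x) \<in> r"
      then show ?thesis using A B common_upper xy by blast
    next
      assume "(p, x) \<in> r" "(q, x) \<notin> r"
      then show ?thesis using A B po(3) by (metis antisymD)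
    next
      assume "(p, x) \<notin> r" "(q, x) \<in> r"
      then show ?thesis using A B po(3) by (metis antisymD)
    next
      assume "(p, x) \<notin> r" "(q, x) \<notin> r"
      then show ?thesis using A B common_lower xy by metis
    qed
  qed
  moreover have "f x \<subseteq> X" if "x \<in> P" for x
    using that S(1)[of x] T(1)[of x] X by (auto simp: f_def \<alpha>_def \<beta>_def)
  moreover have "f x \<subseteq> f y" if "x \<in> P" "y \<in> P" "(x, y) \<in> r" for x y
    using \<alpha>_mono[OF that] \<beta>_mono[OF that] by (auto simp: f_def)
  ultimately show ?thesis
    using weak_copy_through[of f P X r p q] pq(1,2) unfolding fpq by blast
qed

section \<open>Concentration of set sizes\<close>

text \<open>
  The variance of a sum of independent signs, multiplied by the number of subsets. Adding a
  point \<open>x\<close> replaces the deviation \<open>d\<close> of a subset by \<open>d - 1\<close> (without \<open>x\<close>) and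
  \<open>d + 1\<close> (with \<open>x\<close>), and \<open>(d - 1)\<^sup>2 + (d + 1)\<^sup>2 = 2 * d\<^sup>2 + 2\<close>.
\<close>

lemma sum_Pow_deviation_squared:
  assumes "finite X"
  shows "(\<Sum>A\<in>Pow X. (2 * real (card A) - real (card X))\<^sup>2) = real (card X) * 2 ^ card X"
  using assms
proof (induction X)
  case empty
  then show ?case by simp
next
  case (insert x X)
  let ?d = "\<lambda>A. 2 * real (card A) - real (card X)"
  have fin: "finite A" "x \<notin> A" if "A \<in> Pow X" for A
    using that insert.hyps finite_subset by auto
  have inj: "inj_on (insert x) (Pow X)"
    using insert.hyps(2) by (intro inj_onI) (auto dest: insert_ident[THEN iffD1, rotated 2])
  have "(\<Sum>A\<in>Pow (insert x X). (2 * real (card A) - real (card (insert x X)))\<^sup>2) =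
        (\<Sum>A\<in>Pow X. (?d A - 1)\<^sup>2) +
        (\<Sum>A\<in>insert x ` Pow X. (2 * real (card A) - real (card (insert x X)))\<^sup>2)"
    unfolding Pow_insert using insert.hyps
    by (subst sum.union_disjoint) (auto simp: algebra_simps)
  also have "(\<Sum>A\<in>insert x ` Pow X. (2 * real (card A) - real (card (insert x X)))\<^sup>2) =
        (\<Sum>A\<in>Pow X. (?d A + 1)\<^sup>2)"
    using insert.hyps fin by (subst sum.reindex[OF inj]) (auto intro!: sum.cong simp: algebra_simps)
  also have "(\<Sum>A\<in>Pow X. (?d A - 1)\<^sup>2) + (\<Sum>A\<in>Pow X. (?d A + 1)\<^sup>2) =
        (\<Sum>A\<in>Pow X. 2 * (?d A)\<^sup>2 + 2)"
    unfolding sum.distrib[symmetric] by (intro sum.cong) (auto simp: power2_eq_square algebra_simps)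
  also have "\<dots> = 2 * (\<Sum>A\<in>Pow X. (?d A)\<^sup>2) + 2 * 2 ^ card X"
    using insert.hyps by (simp add: sum.distrib sum_distrib_left card_Pow)
  also have "\<dots> = real (card (insert x X)) * 2 ^ card (insert x X)"
    unfolding insert.IH using insert.hyps by (simp add: algebra_simps)
  finally show ?case .
qed

text \<open>
  The window \<open>2 / 5\<close> to \<open>3 / 5\<close> of the ground set is wide enough for a Chebyshev bound and
  narrow enough for the three-set argument below, which needs \<open>3 * (n / 5) < n\<close> with
  linear slack.
\<close>

definition middle_sets :: "nat \<Rightarrow> nat set set" where
  "middle_sets n = {A \<in> Pow {1..n}. 2 * n \<le> 5 * card A \<and> 5 * card A \<le> 3 * n}"

text \<open>
  Chebyshev's inequality: every set outside the window contributes at least \<open>n\<^sup>2 / 25\<close> to the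
  sum of squared deviations, which is \<open>n * 2 ^ n\<close>.
\<close>

lemma card_middle_sets_ge:
  assumes "n \<ge> 1"
  shows "(1 - 25 / real n) * 2 ^ n \<le> real (card (middle_sets n))"
proof -
  define E where "E = Pow {1..n} - middle_sets n"
  have far: "(real n)\<^sup>2 \<le> 25 * (2 * real (card A) - real n)\<^sup>2" if "A \<in> E" for A
  proof -
    have "real n \<le> \<bar>5 * (2 * real (card A) - real n)\<bar>"
      using that by (auto simp: E_def middle_sets_def)
    from power_mono[OF this, of 2] show ?thesis unfolding power2_abs power_mult_distrib by simp
  qed
  have "real (card E) * (real n)\<^sup>2 = (\<Sum>A\<in>E. (real n)\<^sup>2)" by simp
  also have "\<dots> \<le> (\<Sum>A\<in>E. 25 * (2 * real (card A) - real n)\<^sup>2)"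
    using far by (intro sum_mono)
  also have "\<dots> \<le> (\<Sum>A\<in>Pow {1..n}. 25 * (2 * real (card A) - real n)\<^sup>2)"
    by (intro sum_mono2) (auto simp: E_def)
  also have "\<dots> = 25 * (real n * 2 ^ n)"
    using sum_Pow_deviation_squared[of "{1..n}"] by (simp flip: sum_distrib_left)
  finally have "real (card E) \<le> 25 / real n * 2 ^ n"
    using assms by (simp add: field_simps power2_eq_square)
  moreover have "card E = 2 ^ n - card (middle_sets n)"
    unfolding E_def by (subst card_Diff_subset) (auto simp: middle_sets_def card_Pow)
  moreover have "card (middle_sets n) \<le> 2 ^ n"
    using card_mono[of "Pow {1..n}" "middle_sets n"] by (auto simp: middle_sets_def card_Pow)
  ultimately show ?thesis
    by (simp add: of_nat_diff algebra_simps)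
qed

section \<open>Monochromatic middle sets\<close>

lemma card_two_sets:
  assumes "finite X" "A \<subseteq> X" "B \<subseteq> X"
  shows "card A = card (A - B) + card (A \<inter> B)" "card B = card (B - A) + card (A \<inter> B)"
    "card X = card (A - B) + card (B - A) + card (A \<inter> B) + card (X - (A \<union> B))"
proof -
  have fin: "finite A" "finite B" using assms finite_subset by auto
  show 1: "card A = card (A - B) + card (A \<inter> B)"
    using fin by (metis card_Diff_subset_Int card_Int_Diff add.commute finite_Int)
  show 2: "card B = card (B - A) + card (A \<inter> B)"
    using fin by (metis card_Int_Diff add.commute Int_commute)
  have "card X = card (X - (A \<union> B)) + card (A \<union> B)"
    using assms fin by (metis Un_least card_Diff_subset card_mono finite_UnI le_add_diff_inverse2)
  moreover have "card (A \<union> B) + card (A \<inter> B) = card A + card B"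
    using fin by (rule card_Un_Int[symmetric])
  ultimately show "card X = card (A - B) + card (B - A) + card (A \<inter> B) + card (X - (A \<union> B))"
    using 1 2 by linarith
qed

text \<open>
  If both differences \<open>A - B\<close> and \<open>B - A\<close> are large, the good pair provides a copy through
  \<open>A\<close> and \<open>B\<close>. If one of them has at most \<open>card P\<close> points, then \<open>A \<inter> B\<close> is nearly one of the
  two sets and \<open>A \<union> B\<close> nearly the other, so there is room below and above.
\<close>

lemma rainbow_inj_on_middle_sets:
  assumes P: "finite P" "partial_order_on P r" "weak_good P r p q"
    and c: "rainbow_coloring n P r c" and n: "n > 15 * card P"
  shows "inj_on c (middle_sets n)"
proof (rule inj_onI, rule ccontr)
  fix A B assume AB: "A \<in> middle_sets n" "B \<in> middle_sets n" "c A = c B" "A \<noteq> B"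
  have sub: "A \<subseteq> {1..n}" "B \<subseteq> {1..n}" using AB by (auto simp: middle_sets_def)
  have inc: "incomparable P r p q" using P(3) by (simp add: weak_good_def)
  note cards = card_two_sets[OF finite_atLeastAtMost sub, unfolded card_atLeastAtMost diff_Suc_1]
  have "\<exists>G \<subseteq> Pow {1..n}. weak_copy P r G \<and> A \<in> G \<and> B \<in> G"
  proof (cases "card P < card (A - B) \<and> card P < card (B - A)")
    case True
    then show ?thesis using weak_copy_through_good_pair[OF P _ sub] by auto
  next
    case False
    then have "card P < card (A \<inter> B)" "card P \<le> card ({1..n} - (A \<union> B))"
      using cards n AB(1,2) by (auto simp: middle_sets_def)
    then show ?thesis
      using weak_copy_through_pair_with_room[OF P(1,2) inc _ sub AB(4)] by auto
  qed
  then show False using rainbow_coloring_separates[OF c _ AB(4)] AB(3) by blast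
qed

text \<open>
  Two middle sets of one color leave no room below or no room above. In the first case they are
  nearly disjoint, in the second they nearly cover the ground set. As each contains between
  \<open>2 / 5\<close> and \<open>3 / 5\<close> of the points, either case leaves little more than \<open>n / 5\<close> points
  that belong to both sets or to neither.
\<close>

lemma agreement_of_monochromatic_pair:
  assumes P: "finite P" "partial_order_on P r" "incomparable P r p q"
    and c: "rainbow_coloring n P r c"
    and AB: "A \<in> middle_sets n" "B \<in> middle_sets n" "c A = c B" "A \<noteq> B"
  shows "5 * card ((A \<inter> B) \<union> ({1..n} - (A \<union> B))) \<le> n + 10 * card P"
proof -
  have sub: "A \<subseteq> {1..n}" "B \<subseteq> {1..n}" using AB by (auto simp: middle_sets_def)
  note cards = card_two_sets[OF finite_atLeastAtMost sub, unfolded card_atLeastAtMost diff_Suc_1]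
  \<comment> \<open>The rest is linear arithmetic in the sizes of the four regions cut out by \<open>A\<close> and \<open>B\<close>.\<close>
  have "\<not> (card P < card (A \<inter> B) \<and> card P \<le> card ({1..n} - (A \<union> B)))"
    using weak_copy_through_pair_with_room[OF P _ sub AB(4)]
      rainbow_coloring_separates[OF c _ AB(4)] AB(3) by auto
  moreover have "card ((A \<inter> B) \<union> ({1..n} - (A \<union> B))) = card (A \<inter> B) + card ({1..n} - (A \<union> B))"
    using sub by (intro card_Un_disjoint) (auto intro: finite_subset)
  ultimately show ?thesis
    using cards AB(1,2) unfolding middle_sets_def mem_Collect_eq by linarith
qed

text \<open>
  Three sets cannot be pairwise nearly complementary: by pigeonhole every point is treated
  alike by some two of \<open>A\<close>, \<open>B\<close>, \<open>C\<close>, so their three agreement sets cover the ground set,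
  although each has at most \<open>n / 5 + 2 * card P\<close> points. The bound \<open>15 * card P\<close> on \<open>n\<close> makes
  three times this number smaller than \<open>n\<close>.
\<close>

lemma rainbow_classes_in_middle_sets:
  assumes P: "finite P" "partial_order_on P r" "incomparable P r p q"
    and c: "rainbow_coloring n P r c" and n: "n > 15 * card P"
  shows "card {A \<in> middle_sets n. c A = k} \<le> 2"
proof (rule ccontr)
  assume "\<not> ?thesis"
  then have "card {A \<in> middle_sets n. c A = k} \<ge> 3" by simp
  then obtain Y where Y: "Y \<subseteq> {A \<in> middle_sets n. c A = k}" "card Y = 3"
    using obtain_subset_with_card_n by metis
  then obtain A B C where ABC: "Y = {A, B, C}" "A \<noteq> B" "B \<noteq> C" "A \<noteq> C"
    by (auto simp: card_3_iff)
  define N where "N A B = (A \<inter> B) \<union> ({1..n} - (A \<union> B))" for A B :: "nat set"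
  have small: "5 * card (N D E) \<le> n + 10 * card P" if "D \<in> Y" "E \<in> Y" "D \<noteq> E" for D E
    unfolding N_def using that Y
    by (intro agreement_of_monochromatic_pair[OF P c]) auto
  have "A \<subseteq> {1..n}" "B \<subseteq> {1..n}"
    using Y(1) ABC(1) by (simp_all add: middle_sets_def)
  then have fin: "finite (N A B)" "finite (N B C)" "finite (N A C)"
    unfolding N_def by (auto intro: finite_subset)
  have "{1..n} \<subseteq> N A B \<union> N B C \<union> N A C" by (auto simp: N_def)
  then have "card {1..n} \<le> card (N A B \<union> N B C \<union> N A C)"
    using fin by (intro card_mono) auto
  also have "\<dots> \<le> card (N A B) + card (N B C) + card (N A C)"
    using card_Un_le[of "N A B \<union> N B C" "N A C"] card_Un_le[of "N A B" "N B C"] by linarith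
  finally show False
    using small[of A B] small[of B C] small[of A C] ABC n by simp
qed

section \<open>Lower bounds for the number of colors\<close>

lemma ar_m_full_ge_of_weak_good:
  assumes P: "finite P" "partial_order_on P r" "weak_good P r p q" and n: "n > 15 * card P"
  shows "(1 - 25 / real n) * 2 ^ n \<le> real (ar_m n (2 ^ n) P r)"
proof -
  obtain c :: "nat set \<Rightarrow> nat" where c: "rainbow_coloring n P r c"
    "card (c ` Pow {1..n}) \<le> ar_m n (2 ^ n) P r"
    by (rule ar_m_full_attained)
  have "card (middle_sets n) = card (c ` middle_sets n)"
    using rainbow_inj_on_middle_sets[OF P c(1) n] by (simp add: card_image)
  also have "\<dots> \<le> card (c ` Pow {1..n})"
    by (intro card_mono) (auto simp: middle_sets_def)
  finally show ?thesis
    using card_middle_sets_ge[of n] c(2) n by simp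
qed

lemma ar_m_full_ge_of_incomparable:
  assumes P: "finite P" "partial_order_on P r" "incomparable P r p q" and n: "n > 15 * card P"
  shows "(1 / 2 - 25 / (2 * real n)) * 2 ^ n \<le> real (ar_m n (2 ^ n) P r)"
proof -
  obtain c :: "nat set \<Rightarrow> nat" where c: "rainbow_coloring n P r c"
    "card (c ` Pow {1..n}) \<le> ar_m n (2 ^ n) P r"
    by (rule ar_m_full_attained)
  have fin: "finite (middle_sets n)" by (simp add: middle_sets_def)
  have "card (middle_sets n) = card (\<Union>k \<in> c ` middle_sets n. {A \<in> middle_sets n. c A = k})"
    by (rule arg_cong[of _ _ card]) auto
  also have "\<dots> \<le> (\<Sum>k \<in> c ` middle_sets n. card {A \<in> middle_sets n. c A = k})"
    using fin by (intro card_UN_le) auto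
  also have "\<dots> \<le> (\<Sum>k \<in> c ` middle_sets n. 2)"
    by (intro sum_mono rainbow_classes_in_middle_sets[OF P c(1) n])
  also have "\<dots> = 2 * card (c ` middle_sets n)" by simp
  also have "card (c ` middle_sets n) \<le> card (c ` Pow {1..n})"
    by (intro card_mono) (auto simp: middle_sets_def)
  finally have "real (card (middle_sets n)) \<le> 2 * real (ar_m n (2 ^ n) P r)"
    using c(2) by linarith
  moreover have "(1 - 25 / real n) * 2 ^ n \<le> real (card (middle_sets n))"
    using card_middle_sets_ge[of n] n by simp
  ultimately have "(1 - 25 / real n) * 2 ^ n \<le> 2 * real (ar_m n (2 ^ n) P r)" by linarith
  then show ?thesis by (simp add: field_simps)
qed

section \<open>Coloring by complementary pairs\<close>

text \<open>
  Complementary sets share a color, named by the member of the pair that avoids \<open>n\<close>. The pair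
  of \<open>{}\<close> and \<open>{1..n}\<close> is exempt, since these two are comparable and can
  occur together in a copy.
\<close>

definition complement_color :: "nat \<Rightarrow> nat set \<Rightarrow> nat set" where
  "complement_color n A = (if A \<noteq> {1..n} \<and> n \<in> A then {1..n} - A else A)"

lemma complement_color_eqD:
  assumes "n \<ge> 1" "A \<subseteq> {1..n}" "B \<subseteq> {1..n}" "complement_color n A = complement_color n B" "A \<noteq> B"
  shows "B = {1..n} - A" "A \<noteq> {}" "B \<noteq> {}"
proof -
  have "n \<in> {1..n}" using assms(1) by simp
  then show "B = {1..n} - A" "A \<noteq> {}" "B \<noteq> {}"
    using assms(2-5) unfolding complement_color_def by (auto split: if_splits)
qed

text \<open>
  Two members of a copy with the same color are complementary and nonempty, hence they are
  incomparable, and so are their preimages \<open>p\<close> and \<open>q\<close>. But the only set containing both is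
  \<open>{1..n}\<close> and the only set contained in both is \<open>{}\<close>, so \<open>p\<close> and \<open>q\<close> have at most one common
  upper and at most one common lower bound: they are not weak bad.
\<close>

lemma rainbow_complement_color:
  assumes P: "finite P" "partial_order_on P r"
    and bad: "\<And>p q. incomparable P r p q \<Longrightarrow> weak_bad P r p q"
    and n: "n \<ge> 1"
  shows "rainbow_coloring n P r (complement_color n)"
  unfolding rainbow_coloring_def
proof (intro allI impI inj_onI, rule ccontr)
  fix G A B
  assume G: "G \<subseteq> Pow {1..n} \<and> weak_copy P r G" and AB: "A \<in> G" "B \<in> G"
    "complement_color n A = complement_color n B" "A \<noteq> B"
  have B: "B = {1..n} - A" "A \<noteq> {}" "B \<noteq> {}" and sub: "A \<subseteq> {1..n}"
    using complement_color_eqD[OF n _ _ AB(3,4)] G AB(1,2) by auto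
  obtain f where f: "bij_betw f P G" "\<And>p q. p \<in> P \<Longrightarrow> q \<in> P \<Longrightarrow> (p, q) \<in> r \<Longrightarrow> f p \<subseteq> f q"
    using G by (auto simp: weak_copy_def)
  obtain p q where pq: "p \<in> P" "q \<in> P" "f p = A" "f q = B"
    using f(1) AB by (auto simp: bij_betw_def)
  \<comment> \<open>A nonempty set is not contained in its complement.\<close>
  have "(p, q) \<notin> r" "(q, p) \<notin> r"
    using f(2)[of p q] f(2)[of q p] pq B sub by auto
  then have "weak_bad P r p q" using pq by (intro bad) (auto simp: incomparable_def)
  moreover have at_most_one: "card Y < 2"
    if "Y \<subseteq> P" "\<And>x. x \<in> Y \<Longrightarrow> f x = Z" for Y and Z :: "nat set"
  proof -
    have "x = y" if "x \<in> Y" "y \<in> Y" for x y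
      using that \<open>Y \<subseteq> P\<close> \<open>\<And>x. x \<in> Y \<Longrightarrow> f x = Z\<close> f(1)
      by (metis bij_betw_def inj_onD subsetD)
    then have "card Y \<le> Suc 0"
      using card_le_Suc0_iff_eq[of Y] finite_subset[OF \<open>Y \<subseteq> P\<close> P(1)] by auto
    then show ?thesis by simp
  qed
  moreover have "card (upper_set P r p \<inter> upper_set P r q) < 2"
  proof (rule at_most_one[of _ "{1..n}"])
    fix x assume "x \<in> upper_set P r p \<inter> upper_set P r q"
    then have "A \<subseteq> f x" "B \<subseteq> f x" "f x \<in> G"
      using f pq by (auto simp: upper_set_def bij_betw_def)
    then show "f x = {1..n}" using B(1) G by auto
  qed (auto simp: upper_set_def)
  moreover have "card (lower_set P r p \<inter> lower_set P r q) < 2"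
  proof (rule at_most_one[of _ "{}"])
    fix x assume "x \<in> lower_set P r p \<inter> lower_set P r q"
    then have "f x \<subseteq> A" "f x \<subseteq> B" using f(2) pq by (auto simp: lower_set_def)
    then show "f x = {}" using B(1) by auto
  qed (auto simp: lower_set_def)
  ultimately show False by (auto simp: weak_bad_def)
qed

text \<open>
  The colors are the \<open>2 ^ (n - 1)\<close> sets that avoid \<open>n\<close>, and the set \<open>{1..n}\<close>.
\<close>

lemma ar_m_full_le_of_all_weak_bad:
  assumes P: "finite P" "partial_order_on P r"
    and bad: "\<And>p q. incomparable P r p q \<Longrightarrow> weak_bad P r p q"
    and n: "n \<ge> 1"
  shows "real (ar_m n (2 ^ n) P r) \<le> (1 / 2 + 1 / 2 ^ n) * 2 ^ n"
proof -
  have "complement_color n ` Pow {1..n} \<subseteq> insert {1..n} (Pow {1..<n})"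
  proof (rule image_subsetI)
    fix A assume "A \<in> Pow {1..n}"
    moreover have "{1..n} = insert n {1..<n}" using n by auto
    ultimately show "complement_color n A \<in> insert {1..n} (Pow {1..<n})"
      unfolding complement_color_def by auto
  qed
  then have "card (complement_color n ` Pow {1..n}) \<le> card (insert {1..n} (Pow {1..<n}))"
    by (intro card_mono) auto
  also have "\<dots> \<le> 2 ^ (n - 1) + 1"
    by (simp add: card_insert_if card_Pow)
  finally have "ar_m n (2 ^ n) P r \<le> 2 ^ (n - 1) + 1"
    using ar_m_full_le_card_image[OF rainbow_complement_color[OF P bad n]] by simp
  then have "real (ar_m n (2 ^ n) P r) \<le> real (2 ^ (n - 1) + 1)"
    by (rule of_nat_mono)
  also have "\<dots> = (1 / 2 + 1 / 2 ^ n) * 2 ^ n"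
    using n by (cases n) (auto simp: field_simps)
  finally show ?thesis .
qed

section \<open>Asymptotics\<close>

lemma little_o_error_of_squeeze:
  fixes a :: "nat \<Rightarrow> real"
  assumes "\<And>n. n > N \<Longrightarrow> (L - g n) * 2 ^ n \<le> a n" "\<And>n. n > N \<Longrightarrow> a n \<le> (L + h n) * 2 ^ n"
    and "g \<longlonglongrightarrow> 0" "h \<longlonglongrightarrow> 0"
  shows "\<exists>\<epsilon>::nat \<Rightarrow> real. \<epsilon> \<in> o(\<lambda>_. 1) \<and> (\<forall>n\<ge>1. a n = (L + \<epsilon> n) * 2 ^ n)"
proof (intro exI conjI allI impI)
  define \<epsilon> where "\<epsilon> n = a n / 2 ^ n - L" for n
  have "\<epsilon> \<longlonglongrightarrow> 0"
  proof (rule tendsto_sandwich)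
    show "(\<lambda>n. - g n) \<longlonglongrightarrow> 0" using tendsto_minus[OF assms(3)] by simp
    show "eventually (\<lambda>n. - g n \<le> \<epsilon> n) sequentially"
      using eventually_gt_at_top[of N]
      by eventually_elim (use assms(1) in \<open>auto simp: \<epsilon>_def field_simps\<close>)
    show "eventually (\<lambda>n. \<epsilon> n \<le> h n) sequentially"
      using eventually_gt_at_top[of N]
      by eventually_elim (use assms(2) in \<open>auto simp: \<epsilon>_def field_simps\<close>)
  qed (fact assms(4))
  then show "\<epsilon> \<in> o(\<lambda>_. 1)" by (intro smalloI_tendsto) auto
  show "a n = (L + \<epsilon> n) * 2 ^ n" for n by (simp add: \<epsilon>_def)
qed

theorem theorem1p5:
  fixes P :: "'a set" and r :: "'a rel"
  assumes "finite P" and "partial_order_on P r"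
    and "\<not> total_on P r" and "\<not> poset_antichain P r"
  shows "((\<exists>p q. weak_good P r p q) \<longrightarrow>
           (\<exists>\<epsilon>::nat \<Rightarrow> real. \<epsilon> \<in> o(\<lambda>_. 1) \<and>
             (\<forall>n\<ge>1. real (ar_m n (2 ^ n) P r) = (1 + \<epsilon> n) * 2 ^ n))) \<and>
         ((\<forall>p q. incomparable P r p q \<longrightarrow> weak_bad P r p q) \<longrightarrow>
           (\<exists>\<epsilon>::nat \<Rightarrow> real. \<epsilon> \<in> o(\<lambda>_. 1) \<and>
             (\<forall>n\<ge>1. real (ar_m n (2 ^ n) P r) = (1 / 2 + \<epsilon> n) * 2 ^ n)))"
proof (intro conjI impI)
  assume "\<exists>p q. weak_good P r p q"
  then obtain p q where good: "weak_good P r p q" by blast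
  show "\<exists>\<epsilon>::nat \<Rightarrow> real. \<epsilon> \<in> o(\<lambda>_. 1) \<and>
      (\<forall>n\<ge>1. real (ar_m n (2 ^ n) P r) = (1 + \<epsilon> n) * 2 ^ n)"
  proof (rule little_o_error_of_squeeze)
    show "(1 - 25 / real n) * 2 ^ n \<le> real (ar_m n (2 ^ n) P r)" if "n > 15 * card P" for n
      by (rule ar_m_full_ge_of_weak_good[OF assms(1,2) good that])
    show "real (ar_m n (2 ^ n) P r) \<le> (1 + 0) * 2 ^ n" for n
      using of_nat_mono[OF ar_m_full_le[of n P r], where ?'a = real] by simp
    show "(\<lambda>n. 25 / real n) \<longlonglongrightarrow> 0" by (rule lim_const_over_n)
  qed simp
next
  assume bad: "\<forall>p q. incomparable P r p q \<longrightarrow> weak_bad P r p q"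
  \<comment> \<open>Any incomparable pair serves to show that classes of middle sets have at most two members.\<close>
  obtain p q where inc: "incomparable P r p q"
    using assms(3) by (auto simp: total_on_def incomparable_def)
  show "\<exists>\<epsilon>::nat \<Rightarrow> real. \<epsilon> \<in> o(\<lambda>_. 1) \<and>
      (\<forall>n\<ge>1. real (ar_m n (2 ^ n) P r) = (1 / 2 + \<epsilon> n) * 2 ^ n)"
  proof (rule little_o_error_of_squeeze)
    show "(1 / 2 - 25 / (2 * real n)) * 2 ^ n \<le> real (ar_m n (2 ^ n) P r)"
      if "n > 15 * card P" for n
      by (rule ar_m_full_ge_of_incomparable[OF assms(1,2) inc that])
    show "real (ar_m n (2 ^ n) P r) \<le> (1 / 2 + 1 / 2 ^ n) * 2 ^ n" if "n > 15 * card P" for n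
      using ar_m_full_le_of_all_weak_bad[OF assms(1,2)] bad that by auto
    show "(\<lambda>n. 25 / (2 * real n)) \<longlonglongrightarrow> 0"
      using lim_const_over_n[of "25 / 2"] by simp
    show "(\<lambda>n. 1 / 2 ^ n :: real) \<longlonglongrightarrow> 0"
      using LIMSEQ_power_zero[of "1 / 2 :: real"] by (simp add: power_one_over)
  qed
qed

end
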